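(* For an integer $n \geq 3$, let $W_n$ be the wheel graph of order $n+1$. Then $$\phi_{\mathbb{C}}(W_n) = \begin{cases} 2 & \text{if } n \text{ is even},\\ 1 + 2\sin\left(\frac{\pi}{6}\cdot\frac{n}{n-1}\right) & \text{if } n \equiv 1 \text{ or } 3 \pmod 6,\\ 1 + 2\sin\left(\frac{\pi}{6}\cdot\frac{n+1}{n}\right) & \text{if } n \equiv 5 \pmod 6.\end{cases}$$
   Context: The wheel graph $W_n$ ($n\ge 3$) consists of a cycle $v_0v_1\cdots v_{n-1}v_0$ of length $n$ together with one further vertex $u$ adjacent to every $v_j$. For a real number $r \geq 2$, a complex nowhere-zero $r$-flow on a graph $G$ is an orientation of $G$ together with a map $\varphi\colon E(G)\to\mathbb{C}$ such that $1 \le |\varphi(e)| \le r-1$ for every edge $e$ and, at every vertex, the sum of the values on incoming edges equals the sum of the values on outgoing edges. For a bridgeless graph $G$, the complex flow number $\phi_{\mathbb{C}}(G)$ is the minimum (equivalently infimum; it is attained) of the real numbers $r\ge 2$ such that $G$ admits a complex nowhere-zero $r$-flow. *)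

theory Defs
  imports Complex_Main
begin

text \<open>A (multi)graph is given by a vertex set V, an edge set E and an endpoint map
  ends :: 'e => 'v * 'v.  An orientation is a map ori :: 'e => bool; if ori e holds
  the edge e = (a,b) is directed from a to b, otherwise from b to a.\<close>

definition otail :: "('e \<Rightarrow> 'v \<times> 'v) \<Rightarrow> ('e \<Rightarrow> bool) \<Rightarrow> 'e \<Rightarrow> 'v" where
  "otail ends ori e = (if ori e then fst (ends e) else snd (ends e))"

definition ohead :: "('e \<Rightarrow> 'v \<times> 'v) \<Rightarrow> ('e \<Rightarrow> bool) \<Rightarrow> 'e \<Rightarrow> 'v" where
  "ohead ends ori e = (if ori e then snd (ends e) else fst (ends e))"

definition complex_nz_flow ::
  "'v set \<Rightarrow> 'e set \<Rightarrow> ('e \<Rightarrow> 'v \<times> 'v) \<Rightarrow> real \<Rightarrow> bool" where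
  "complex_nz_flow V E ends r \<longleftrightarrow>
     (\<exists>(ori :: 'e \<Rightarrow> bool) (phi :: 'e \<Rightarrow> complex).
        (\<forall>e\<in>E. 1 \<le> cmod (phi e) \<and> cmod (phi e) \<le> r - 1) \<and>
        (\<forall>v\<in>V. (\<Sum>e\<in>{e\<in>E. ohead ends ori e = v}. phi e) =
                (\<Sum>e\<in>{e\<in>E. otail ends ori e = v}. phi e)))"

definition complex_flow_number ::
  "'v set \<Rightarrow> 'e set \<Rightarrow> ('e \<Rightarrow> 'v \<times> 'v) \<Rightarrow> real" where
  "complex_flow_number V E ends = Inf {r. r \<ge> 2 \<and> complex_nz_flow V E ends r}"

text \<open>Wheel W_n: hub None, rim vertices Some j (j < n); rim edges Inl j joining
  Some j and Some ((j+1) mod n), spokes Inr j joining None and Some j.\<close>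

definition wheel_V :: "nat \<Rightarrow> nat option set" where
  "wheel_V n = insert None (Some ` {..<n})"

definition wheel_E :: "nat \<Rightarrow> (nat + nat) set" where
  "wheel_E n = Inl ` {..<n} \<union> Inr ` {..<n}"

definition wheel_ends :: "nat \<Rightarrow> nat + nat \<Rightarrow> nat option \<times> nat option" where
  "wheel_ends n e = (case e of Inl j \<Rightarrow> (Some j, Some ((j + 1) mod n))
                              | Inr j \<Rightarrow> (None, Some j))"

end

theory Submission
  imports Defs
begin

text \<open>
  A flow on the wheel is determined by its rim values \<open>z\<^sub>j\<close>, the spokes carrying their cyclic
  differences; so one asks for a closed sequence in the annulus \<open>1 \<le> |z| \<le> R\<close>, where \<open>R = r - 1\<close>,
  whose consecutive differences also have modulus in \<open>[1, R]\<close>.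
  Consecutive terms subtend a positive or negative angle close to \<open>pi / 3\<close>, and the signed angles
  add up to a multiple of \<open>2 * pi\<close>. For odd \<open>n\<close> the signed deviations from \<open>pi / 3\<close> therefore add up
  to an odd multiple of \<open>pi / 3\<close>. With \<open>D = 2 * arcsin (R / 2) - pi / 3\<close> and
  \<open>P a = arcsin (R / (2 * a)) - pi / 6\<close>, which lies in \<open>[0, D / 2]\<close>, the deviation between terms of
  modulus \<open>a\<close> and \<open>b\<close> lies in \<open>[P a + P b - D, P a + P b]\<close>. Hence each deviation is at most \<open>D\<close>,
  and every change of sign around the cycle costs \<open>D / 2\<close>; since there are at least two changes if
  there is any, mixed signs give a total of at most \<open>(n - 1) * D\<close>. If all signs agree, the total
  \<open>pi / 3\<close> can be an excess only for \<open>n \<equiv> 5 (mod 6)\<close>; for \<open>n \<equiv> 1\<close> it is a deficit, which is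
  bounded through the smallest possible angle \<open>2 * arcsin (1 / (2 * R))\<close>.
\<close>

subsection \<open>Angles of triangles with bounded sides\<close>

lemma angle_le_of_cos_le:
  fixes x y :: real
  assumes "cos y \<le> cos x" "0 \<le> y" "y \<le> pi" "0 \<le> x" "x \<le> pi"
  shows "x \<le> y"
  using assms cos_mono_le_eq by blast

lemma arcsin_unit_interval:
  fixes y :: real
  assumes "0 \<le> y" "y \<le> 1"
  shows "sin (arcsin y) = y" "0 \<le> arcsin y" "arcsin y \<le> pi / 2"
  using assms arcsin_le_arcsin[of 0 y] arcsin_ubound[of y] by auto

text \<open>Twice \<open>arcsin (R / (2 * a))\<close> is the apex angle of the isosceles triangle
  with legs \<open>a\<close> and base \<open>R\<close>, so the bound averages two isosceles angles.
  The comparison is made on cosines, where it becomes the inequality of arithmetic and geometric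
  means.\<close>

lemma triangle_angle_upper:
  fixes a b d R t :: real
  assumes a: "1 \<le> a" and b: "1 \<le> b" and d: "0 \<le> d" "d \<le> R" and R: "1 \<le> R" "R \<le> 2"
    and t: "0 \<le> t" "t \<le> pi" and law: "d\<^sup>2 = a\<^sup>2 + b\<^sup>2 - 2 * a * b * cos t"
  shows "t \<le> arcsin (R / (2 * a)) + arcsin (R / (2 * b))"
proof -
  define x where "x = arcsin (R / (2 * a))"
  define y where "y = arcsin (R / (2 * b))"
  have ra: "0 \<le> R / (2 * a)" "R / (2 * a) \<le> 1" and rb: "0 \<le> R / (2 * b)" "R / (2 * b) \<le> 1"
    using a b R by (auto simp: field_simps)
  have x: "0 \<le> x" "x \<le> pi / 2" and y: "0 \<le> y" "y \<le> pi / 2"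
    unfolding x_def y_def using arcsin_unit_interval[OF ra] arcsin_unit_interval[OF rb] by auto
  have sx: "sin x = R / (2 * a)" and sy: "sin y = R / (2 * b)"
    unfolding x_def y_def using ra rb by (auto intro!: sin_arcsin)
  have sa: "sin x * (2 * a) = R" and sb: "sin y * (2 * b) = R"
    using sx sy a b by auto
  have "(2 * a * cos x)\<^sup>2 = 4 * a\<^sup>2 - (sin x * (2 * a))\<^sup>2"
    "(2 * b * cos y)\<^sup>2 = 4 * b\<^sup>2 - (sin y * (2 * b))\<^sup>2"
    by (simp_all add: power_mult_distrib cos_squared_eq algebra_simps)
  then have "(2 * a * cos x)\<^sup>2 = 4 * a\<^sup>2 - R\<^sup>2" "(2 * b * cos y)\<^sup>2 = 4 * b\<^sup>2 - R\<^sup>2"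
    by (simp_all only: sa sb)
  \<comment> \<open>The two squares belong to twice the heights of the isosceles triangles; the
    product of these lengths is at most the mean of their squares.\<close>
  then have "4 * a * b * (cos x * cos y) \<le> 2 * a\<^sup>2 + 2 * b\<^sup>2 - R\<^sup>2"
    using sum_squares_bound[of "2 * a * cos x" "2 * b * cos y"] by (simp add: mult.assoc mult.left_commute)
  moreover have "4 * a * b * (sin x * sin y) = R\<^sup>2"
    using sa sb by (metis (no_types, opaque_lifting) mult.assoc mult.left_commute mult_2 mult_2_right power2_eq_square numeral_Bit0 distrib_left)
  moreover have "d\<^sup>2 \<le> R\<^sup>2" using d by (simp add: power_mono)
  ultimately have "4 * a * b * cos (x + y) \<le> 4 * a * b * cos t"
    using law by (simp add: cos_add algebra_simps)
  then have "cos (x + y) \<le> cos t" using a b by simp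
  then show ?thesis
    using angle_le_of_cos_le[of "x + y" t] x y t by (simp add: x_def y_def)
qed

text \<open>Scaling by \<open>c\<close> can only lower the slope, since
  \<open>1 / sqrt (1 - v\<^sup>2)\<close> increases in \<open>v\<close>. With
  \<open>c = 1 / a\<close> and \<open>c = 1 / b\<close> this makes the lower bound for the angle
  decrease in \<open>R\<close>.\<close>

lemma arcsin_scaled_diff_mono:
  fixes c s u :: real
  assumes c: "0 \<le> c" "c \<le> 1" and su: "0 \<le> s" "s \<le> u" "u < 1"
  shows "arcsin s - arcsin (c * s) \<le> arcsin u - arcsin (c * u)"
proof (rule DERIV_nonneg_imp_nondecreasing[OF \<open>s \<le> u\<close>])
  fix v assume v: "s \<le> v" "v \<le> u"
  have cv: "0 \<le> c * v" "c * v \<le> v" "v < 1" "0 \<le> v"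
    using c su v by (auto simp: mult_left_le_one_le)
  have "(c * v)\<^sup>2 \<le> v\<^sup>2" using cv by (simp add: power_mono)
  have v1: "v\<^sup>2 < 1" using cv by (simp add: power_less_one_iff abs_square_less_1)
  have "c * inverse (sqrt (1 - (c * v)\<^sup>2)) \<le> 1 * inverse (sqrt (1 - v\<^sup>2))"
    using c v1 \<open>(c * v)\<^sup>2 \<le> v\<^sup>2\<close> by (intro mult_mono le_imp_inverse_le) auto
  moreover have "((\<lambda>v. arcsin v - arcsin (c * v)) has_real_derivative
      inverse (sqrt (1 - v\<^sup>2)) - inverse (sqrt (1 - (c * v)\<^sup>2)) * c) (at v)"
    using cv by (auto intro!: derivative_eq_intros)
  ultimately show "\<exists>y. ((\<lambda>v. arcsin v - arcsin (c * v)) has_real_derivative y) (at v) \<and> 0 \<le> y"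
    by (intro exI conjI) (auto simp: mult.commute)
qed

text \<open>The case \<open>R = a\<close> of \<open>triangle_angle_lower\<close>, which is the worst one since the bound there
  decreases in \<open>R\<close>.\<close>

lemma triangle_angle_lower_extreme:
  fixes a b t :: real
  assumes b: "1 \<le> b" "b \<le> a" and a: "a\<^sup>2 \<le> 2" and t: "0 \<le> t" "t \<le> pi"
    and law: "1 \<le> a\<^sup>2 + b\<^sup>2 - 2 * a * b * cos t"
  shows "pi / 2 + arcsin (a / (2 * b)) - 2 * arcsin (a / 2) \<le> t"
proof -
  define m where "m = arcsin (a / 2)"
  define p where "p = arcsin (a / (2 * b))"
  have "a\<^sup>2 < 2\<^sup>2" using a by simp
  then have a2: "a < 2" using b power_less_imp_less_base by fastforce
  have pm: "p \<le> m" unfolding p_def m_def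
    using b a2 by (intro arcsin_le_arcsin) (auto simp: field_simps)
  have r: "0 \<le> a / (2 * b)" "a / (2 * b) \<le> 1"
    using a2 b by (auto simp: field_simps)
  have p0: "0 \<le> p" unfolding p_def using arcsin_unit_interval[OF r] by simp
  have m: "sin m = a / 2" "m \<le> pi / 2" "0 \<le> m"
    unfolding m_def using a2 b arcsin_unit_interval[of "a / 2"] by auto
  have p: "sin p = a / (2 * b)" "p \<le> pi / 2"
    unfolding p_def using arcsin_unit_interval[OF r] by auto
  have cm0: "0 \<le> cos m" and cp0: "0 \<le> cos p"
    using m p p0 by (auto intro!: cos_ge_zero)
  \<comment> \<open>The square roots hidden in \<open>cos m\<close> and \<open>cos p\<close> are
    collected in one nonnegative product, so that only its square has to be known.\<close>
  define X where "X = 2 * cos m * (2 * b * cos p)"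
  have X0: "0 \<le> X" unfolding X_def using cm0 cp0 b by simp
  have "X\<^sup>2 = (4 * (cos m)\<^sup>2) * (4 * b\<^sup>2 * (cos p)\<^sup>2)"
    by (simp add: X_def power_mult_distrib)
  also have "4 * (cos m)\<^sup>2 = 4 - a\<^sup>2"
    by (simp add: cos_squared_eq m power_divide algebra_simps)
  also have "4 * b\<^sup>2 * (cos p)\<^sup>2 = 4 * b\<^sup>2 - a\<^sup>2"
    using b by (simp add: cos_squared_eq p power_divide field_simps)
  finally have X2: "X\<^sup>2 = (4 - a\<^sup>2) * (4 * b\<^sup>2 - a\<^sup>2)" .
  \<comment> \<open>In these variables the desired comparison of cosines is
    \<open>A * (4 - A) + 2 * c \<le> A * X\<close>. Squaring and cancelling reduces it to
    \<open>c \<le> (A - 1) * (A * (4 - A))\<close>, which follows from \<open>c \<le> A - 1\<close>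
    and \<open>1 \<le> A * (4 - A)\<close>.\<close>
  define A where "A = a\<^sup>2"
  define c where "c = b\<^sup>2 - 1"
  have A: "1 \<le> A" "A \<le> 2" using a b by (auto simp: A_def)
  have c: "0 \<le> c" "c \<le> A - 1" using b by (auto simp: A_def c_def power_mono)
  have "1 \<le> A * (4 - A)" using A mult_mono[of 1 A 1 "4 - A"] by simp
  then have "(A - 1) * 1 \<le> (A - 1) * (A * (4 - A))"
    using A by (intro mult_left_mono) auto
  then have "c \<le> (A - 1) * (A * (4 - A))" using c(2) by simp
  then have "4 * c * c \<le> 4 * c * ((A - 1) * (A * (4 - A)))"
    using c by (intro mult_left_mono) auto
  then have "(A * (4 - A) + 2 * c)\<^sup>2 \<le> A\<^sup>2 * ((4 - A) * (4 * (c + 1) - A))"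
    by (simp add: power2_eq_square algebra_simps)
  also have "\<dots> = (A * X)\<^sup>2" by (simp add: power_mult_distrib X2 A_def c_def)
  finally have key: "A * (4 - A) + 2 * c \<le> A * X"
    using power2_le_imp_le X0 A by (meson mult_nonneg_nonneg order_trans zero_le_one)
  have "cos (pi / 2 + p - 2 * m) = sin (2 * m - p)"
    by (simp add: sin_cos_eq algebra_simps)
  also have "\<dots> = 2 * sin m * cos m * cos p - (1 - 2 * (sin m)\<^sup>2) * sin p"
    by (simp add: sin_diff sin_double cos_double_sin)
  finally have c2: "cos (pi / 2 + p - 2 * m) =
    2 * sin m * cos m * cos p - (1 - 2 * (sin m)\<^sup>2) * sin p" .
  have "4 * a * b * cos (pi / 2 + p - 2 * m) =
      4 * a * b * (2 * sin m * cos m * cos p) - 4 * a * b * sin p * (1 - 2 * (sin m)\<^sup>2)"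
    unfolding c2 by (simp add: algebra_simps)
  also have "4 * a * b * (2 * sin m * cos m * cos p) = A * X"
    by (simp add: m A_def X_def power2_eq_square)
  also have "4 * a * b * sin p = 2 * A" using b by (simp add: p A_def power2_eq_square)
  finally have "4 * a * b * cos (pi / 2 + p - 2 * m) = A * X - 2 * A * (1 - 2 * (sin m)\<^sup>2)" .
  then have "4 * a * b * cos (pi / 2 + p - 2 * m) = A * X - A * (2 - A)"
    by (simp add: m A_def power_divide algebra_simps)
  moreover have "4 * a * b * cos t \<le> 2 * (A + c)" using law by (simp add: A_def c_def)
  ultimately have "4 * a * b * cos t \<le> 4 * a * b * cos (pi / 2 + p - 2 * m)"
    using key by (simp add: algebra_simps)
  then have cc: "cos t \<le> cos (pi / 2 + p - 2 * m)" using b by simp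
  show ?thesis
  proof (cases "0 \<le> pi / 2 + p - 2 * m")
    case True
    then show ?thesis
      using angle_le_of_cos_le[OF cc] t m pm p p0 by (simp add: m_def p_def)
  next
    case False
    then show ?thesis using t by (simp add: m_def p_def)
  qed
qed

lemma triangle_angle_lower:
  fixes a b R t :: real
  assumes a: "1 \<le> a" "a \<le> R" and b: "1 \<le> b" "b \<le> R" and R: "R\<^sup>2 \<le> 2"
    and t: "0 \<le> t" "t \<le> pi" and law: "1 \<le> a\<^sup>2 + b\<^sup>2 - 2 * a * b * cos t"
  shows "arcsin (R / (2 * a)) + arcsin (R / (2 * b)) + pi / 3 - 2 * arcsin (R / 2) \<le> t"
proof -
  have main: "arcsin (R / (2 * a)) + arcsin (R / (2 * b)) + pi / 3 - 2 * arcsin (R / 2) \<le> t"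
    if a: "a \<le> R" and b: "1 \<le> b" "b \<le> a"
    and law: "1 \<le> a\<^sup>2 + b\<^sup>2 - 2 * a * b * cos t" for a b
  proof -
    have "R\<^sup>2 < 2\<^sup>2" using R by simp
    then have R2: "R < 2" using a b power_less_imp_less_base by fastforce
    have "a\<^sup>2 \<le> R\<^sup>2" using a b by (simp add: power_mono)
    then have "a\<^sup>2 \<le> 2" using R by simp
    note ext = triangle_angle_lower_extreme[OF b this t law]
    \<comment> \<open>These two differences, one per side, carry the bound from \<open>R = a\<close>
      to the actual \<open>R\<close>; at \<open>R = a\<close> one arcsine equals
      \<open>pi / 6\<close>, which together with \<open>pi / 3\<close> makes the
      \<open>pi / 2\<close> of \<open>ext\<close>.\<close>
    have "arcsin (a / 2) - arcsin (1 / a * (a / 2)) \<le> arcsin (R / 2) - arcsin (1 / a * (R / 2))"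
      using a b R2 by (intro arcsin_scaled_diff_mono) auto
    moreover have "arcsin (a / 2) - arcsin (1 / b * (a / 2)) \<le> arcsin (R / 2) - arcsin (1 / b * (R / 2))"
      using a b R2 by (intro arcsin_scaled_diff_mono) auto
    moreover have "1 / a * (a / 2) = 1 / 2" "1 / a * (R / 2) = R / (2 * a)"
      "1 / b * (a / 2) = a / (2 * b)" "1 / b * (R / 2) = R / (2 * b)"
      using a b by (auto simp: field_simps)
    moreover have "arcsin (1 / 2) = pi / 6" using arcsin_sin[of "pi / 6"] by (simp add: sin_30)
    ultimately show ?thesis using ext by (simp only:)
  qed
  show ?thesis
  proof (cases "b \<le> a")
    case True
    then show ?thesis using main[of a b] a b law by simp
  next
    case False
    then show ?thesis using main[of b a] a b law by (simp add: algebra_simps)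
  qed
qed

text \<open>The extremal triangle has both legs \<open>R\<close> and base 1, with
  \<open>cos (2 * u) = 1 - 1 / (2 * R\<^sup>2)\<close> for its half angle \<open>u\<close>. Clearing
  denominators turns the comparison with \<open>cos t\<close> into
  \<open>R\<^sup>2 * (a - b)\<^sup>2 + a * b \<le> R\<^sup>2\<close>.\<close>

lemma triangle_angle_ge_isosceles:
  fixes a b R t :: real
  assumes a: "1 \<le> a" "a \<le> R" and b: "1 \<le> b" "b \<le> R" and R: "R\<^sup>2 \<le> 2"
    and t: "0 \<le> t" "t \<le> pi" and law: "1 \<le> a\<^sup>2 + b\<^sup>2 - 2 * a * b * cos t"
  shows "2 * arcsin (1 / (2 * R)) \<le> t"
proof -
  have R1: "1 \<le> R" using a by simp
  have main: "R\<^sup>2 * (a - b)\<^sup>2 + a * b \<le> R\<^sup>2" if a: "a \<le> R" and b: "1 \<le> b" "b \<le> a" for a b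
  proof -
    \<comment> \<open>Together with \<open>a - b \<le> R - 1\<close> this makes the quadratic term
      at most \<open>R * (a - b)\<close>, after which the terms telescope up to
      \<open>R\<^sup>2\<close>.\<close>
    have "R * (R - 1) \<le> 1"
    proof -
      have "(R - 1) * (R - 3/2) \<le> 0"
      proof -
        have "R\<^sup>2 \<le> (3/2)\<^sup>2" using R by (simp add: power2_eq_square)
        then have "R \<le> 3/2" using power2_le_imp_le[of R "3/2"] by simp
        then show ?thesis using R1 by (simp add: mult_nonneg_nonpos)
      qed
      then show ?thesis using R R1 by (simp add: power2_eq_square algebra_simps)
    qed
    have "R\<^sup>2 * (a - b)\<^sup>2 \<le> R\<^sup>2 * ((a - b) * (R - 1))"
      unfolding power2_eq_square using a b by (intro mult_left_mono) auto
    also have "\<dots> = R * (R - 1) * (R * (a - b))" by (simp add: power2_eq_square)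
    also have "\<dots> \<le> 1 * (R * (a - b))"
      using \<open>R * (R - 1) \<le> 1\<close> R1 b by (intro mult_right_mono) auto
    finally have "R\<^sup>2 * (a - b)\<^sup>2 \<le> R * (a - b)" by simp
    moreover have "a * b \<le> R * b" using a b by simp
    moreover have "R * a \<le> R\<^sup>2" using a R1 by (simp add: power2_eq_square)
    ultimately show ?thesis by (simp add: algebra_simps)
  qed
  have m: "R\<^sup>2 * (a - b)\<^sup>2 + a * b \<le> R\<^sup>2"
  proof (cases "b \<le> a")
    case True
    then show ?thesis using main[of a b] a b by simp
  next
    case False
    then show ?thesis using main[of b a] a b by (simp add: power2_commute mult.commute)
  qed
  define u where "u = arcsin (1 / (2 * R))"
  have r: "0 \<le> 1 / (2 * R)" "1 / (2 * R) \<le> 1" using R1 by (auto simp: field_simps)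
  have u: "sin u = 1 / (2 * R)" "0 \<le> u" "u \<le> pi / 2"
    unfolding u_def using arcsin_unit_interval[OF r] by auto
  have "R\<^sup>2 * (2 * a * b * cos t) \<le> R\<^sup>2 * (a\<^sup>2 + b\<^sup>2 - 1)"
    using law by (intro mult_left_mono) auto
  also have "\<dots> = R\<^sup>2 * (a - b)\<^sup>2 - R\<^sup>2 + 2 * a * b * R\<^sup>2"
    by (simp add: power2_eq_square algebra_simps)
  also have "\<dots> \<le> R\<^sup>2 * (2 * a * b) - a * b" using m by (simp add: algebra_simps)
  also have "\<dots> = R\<^sup>2 * (2 * a * b * cos (2 * u))"
  proof -
    have "R\<^sup>2 * cos (2 * u) = R\<^sup>2 - 1 / 2"
      unfolding cos_double_sin u using R1 by (simp add: power_divide field_simps)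
    then have "R\<^sup>2 * cos (2 * u) * (2 * a * b) = (R\<^sup>2 - 1 / 2) * (2 * a * b)" by simp
    then show ?thesis by (simp add: algebra_simps)
  qed
  finally have "(R\<^sup>2 * (2 * a * b)) * cos t \<le> (R\<^sup>2 * (2 * a * b)) * cos (2 * u)"
    by (simp add: algebra_simps)
  moreover have "0 < R\<^sup>2 * (2 * a * b)" using R1 a b by simp
  ultimately have "cos t \<le> cos (2 * u)" by (simp only: mult_le_cancel_left_pos)
  then show ?thesis using angle_le_of_cos_le[of t "2 * u"] u t by (simp add: u_def)
qed

subsection \<open>Cyclic sums of signs and arguments\<close>

lemma inj_on_cyclic_shift: "inj_on (\<lambda>j. Suc j mod n) {..<n}"
proof (rule inj_onI)
  fix i j assume "i \<in> {..<n}" "j \<in> {..<n}" "Suc i mod n = Suc j mod n"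
  then show "i = j" by (cases "Suc i = n"; cases "Suc j = n") auto
qed

lemma bij_betw_cyclic_shift: "bij_betw (\<lambda>j. Suc j mod n) {..<n} {..<n}"
  unfolding bij_betw_def by (intro conjI inj_on_cyclic_shift endo_inj_surj) auto

lemmas sum_cyclic_shift = sum.reindex_bij_betw[OF bij_betw_cyclic_shift]
lemmas prod_cyclic_shift = prod.reindex_bij_betw[OF bij_betw_cyclic_shift]

text \<open>The cyclic differences sum to 0, so a jump of size 2 must be undone elsewhere and the
  total variation is at least 4. Each summand is 2 minus the size of the jump.\<close>

lemma sum_cyclic_sign_changes:
  fixes e :: "nat \<Rightarrow> real"
  assumes e: "\<And>j. j < n \<Longrightarrow> e j = 1 \<or> e j = -1"
    and ex: "i < n" "e i \<noteq> e (Suc i mod n)"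
  shows "(\<Sum>j<n. \<bar>e j + e (Suc j mod n)\<bar>) \<le> 2 * real n - 4"
proof -
  let ?d = "\<lambda>j. e (Suc j mod n) - e j"
  have e': "e (Suc j mod n) = 1 \<or> e (Suc j mod n) = -1" if "j < n" for j
    using that e[of "Suc j mod n"] by simp
  have di: "\<bar>?d i\<bar> = 2" using e[OF ex(1)] e'[OF ex(1)] ex(2) by auto
  have "(\<Sum>j<n. ?d j) = 0" by (simp add: sum_subtractf sum_cyclic_shift)
  then have "?d i + (\<Sum>j\<in>{..<n} - {i}. ?d j) = 0"
    using ex(1) by (simp add: sum.remove[of "{..<n}" i])
  then have "2 = \<bar>\<Sum>j\<in>{..<n} - {i}. ?d j\<bar>" using di by linarith
  also have "\<dots> \<le> (\<Sum>j\<in>{..<n} - {i}. \<bar>?d j\<bar>)" by (rule sum_abs)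
  also have "\<dots> = (\<Sum>j<n. \<bar>?d j\<bar>) - 2"
    using ex(1) di by (simp add: sum.remove[of "{..<n}" i])
  finally have "4 \<le> (\<Sum>j<n. \<bar>?d j\<bar>)" by simp
  moreover have "(\<Sum>j<n. \<bar>e j + e (Suc j mod n)\<bar>) = (\<Sum>j<n. 2 - \<bar>?d j\<bar>)"
    using e e' by (intro sum.cong) fastforce+
  ultimately show ?thesis by (simp add: sum_subtractf)
qed

lemma all_eq_if_cyclically_eq:
  fixes e :: "nat \<Rightarrow> 'a"
  assumes "\<And>i. i < n \<Longrightarrow> e i = e (Suc i mod n)" and "j < n"
  shows "e j = e 0"
  using \<open>j < n\<close>
proof (induction j)
  case (Suc j)
  then show ?case using assms(1)[of j] by simp
qed simp

text \<open>Centred at \<open>D / 4\<close>, the contribution of a vertex is multiplied by the sum of the signs of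
  its two edges, so it vanishes exactly at the sign changes.\<close>

lemma cyclic_signed_sum_bound:
  fixes e f p :: "nat \<Rightarrow> real" and D :: real
  assumes e: "\<And>j. j < n \<Longrightarrow> e j = 1 \<or> e j = -1"
    and ex: "i < n" "e i \<noteq> e (Suc i mod n)"
    and p: "\<And>j. j < n \<Longrightarrow> 0 \<le> p j \<and> p j \<le> D / 2"
    and f: "\<And>j. j < n \<Longrightarrow> f j \<le> p j + p (Suc j mod n) \<and> p j + p (Suc j mod n) - D \<le> f j"
  shows "(\<Sum>j<n. e j * f j) \<le> (real n - 1) * D"
proof -
  define q where "q = (\<lambda>j. p j - D / 4)"
  have q: "\<bar>q j\<bar> \<le> D / 4" if "j < n" for j using p[OF that] by (simp add: q_def abs_le_iff) argo
  have D: "0 \<le> D" using p[OF ex(1)] by simp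
  \<comment> \<open>\<open>q j + q (Suc j mod n)\<close> is the midpoint of the interval of length
    \<open>D\<close> that contains \<open>f j\<close>, so either sign costs at most
    \<open>D / 2\<close>.\<close>
  have "(\<Sum>j<n. e j * f j) \<le> (\<Sum>j<n. D / 2 + e j * (q j + q (Suc j mod n)))"
  proof (rule sum_mono)
    fix j assume "j \<in> {..<n}"
    then show "e j * f j \<le> D / 2 + e j * (q j + q (Suc j mod n))"
      using e[of j] f[of j] by (auto simp: q_def)
  qed
  also have "\<dots> = real n * D / 2 + ((\<Sum>j<n. e j * q j) + (\<Sum>j<n. e j * q (Suc j mod n)))"
    by (simp add: sum.distrib distrib_left)
  \<comment> \<open>Reindexing regroups the sum by vertices: \<open>q (Suc j mod n)\<close> then
    meets the signs of both edges at that vertex.\<close>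
  also have "(\<Sum>j<n. e j * q j) = (\<Sum>j<n. e (Suc j mod n) * q (Suc j mod n))"
    by (rule sum_cyclic_shift[symmetric])
  also have "\<dots> + (\<Sum>j<n. e j * q (Suc j mod n)) = (\<Sum>j<n. (e j + e (Suc j mod n)) * q (Suc j mod n))"
    by (simp add: sum.distrib algebra_simps)
  also have "\<dots> \<le> (\<Sum>j<n. \<bar>e j + e (Suc j mod n)\<bar> * (D / 4))"
  proof (rule sum_mono)
    fix j assume "j \<in> {..<n}"
    then have "\<bar>q (Suc j mod n)\<bar> \<le> D / 4" using q[of "Suc j mod n"] by simp
    then have "\<bar>(e j + e (Suc j mod n)) * q (Suc j mod n)\<bar> \<le> \<bar>e j + e (Suc j mod n)\<bar> * (D / 4)"
      unfolding abs_mult by (intro mult_left_mono) auto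
    then show "(e j + e (Suc j mod n)) * q (Suc j mod n) \<le> \<bar>e j + e (Suc j mod n)\<bar> * (D / 4)"
      by linarith
  qed
  also have "\<dots> = (\<Sum>j<n. \<bar>e j + e (Suc j mod n)\<bar>) * (D / 4)" by (simp add: sum_distrib_right)
  also have "\<dots> \<le> (2 * real n - 4) * (D / 4)"
    using sum_cyclic_sign_changes[OF e ex] D by (intro mult_right_mono) auto
  finally show ?thesis by (simp add: field_simps)
qed

lemma cos_law_Arg:
  fixes z w :: complex
  assumes "z \<noteq> 0" "w \<noteq> 0"
  shows "(cmod (w - z))\<^sup>2 = (cmod z)\<^sup>2 + (cmod w)\<^sup>2 - 2 * cmod z * cmod w * cos \<bar>Arg (w / z)\<bar>"
proof -
  define q where "q = w / z"
  have w: "w = z * q" and "q \<noteq> 0" using assms by (auto simp: q_def)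
  have "(cmod (w - z))\<^sup>2 = (cmod z)\<^sup>2 * (cmod (q - 1))\<^sup>2"
    by (simp add: w norm_mult[symmetric] power_mult_distrib[symmetric] algebra_simps)
  also have "(cmod (q - 1))\<^sup>2 = (cmod q)\<^sup>2 + 1 - 2 * Re q"
    unfolding cmod_power2 by (simp add: power2_eq_square algebra_simps)
  also have "Re q = cmod q * cos \<bar>Arg q\<bar>" using \<open>q \<noteq> 0\<close> by (simp add: cos_Arg)
  finally show ?thesis
    unfolding q_def[symmetric] by (simp add: w norm_mult power2_eq_square algebra_simps)
qed

lemma cis_sum: "cis (\<Sum>j\<in>S. f j) = (\<Prod>j\<in>S. cis (f j))"
  by (induction S rule: infinite_finite_induct) (auto simp: cis_mult[symmetric])

text \<open>The quotients telescope around the cycle, so \<open>cis\<close> of the sum is 1;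
  \<open>k\<close> is a winding number about 0.\<close>

lemma sum_Arg_cyclic:
  fixes z :: "nat \<Rightarrow> complex"
  assumes z: "\<And>j. j < n \<Longrightarrow> z j \<noteq> 0"
  obtains k :: int where "(\<Sum>j<n. Arg (z (Suc j mod n) / z j)) = of_int k * 2 * pi"
proof -
  have z': "z (Suc j mod n) \<noteq> 0" if "j < n" for j using z[of "Suc j mod n"] that by simp
  have "cis (\<Sum>j<n. Arg (z (Suc j mod n) / z j)) = (\<Prod>j<n. sgn (z (Suc j mod n)) / sgn (z j))"
    unfolding cis_sum using z z' by (intro prod.cong) (auto simp: cis_Arg sgn_divide)
  also have "\<dots> = 1"
    using z by (simp add: prod_dividef prod_cyclic_shift[of "\<lambda>j. sgn (z j)"] sgn_zero_iff)
  finally have "cos (\<Sum>j<n. Arg (z (Suc j mod n) / z j)) = 1" by (metis cis.sel(1) one_complex.sel(1))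
  then show ?thesis using that cos_one_2pi_int by blast
qed

section \<open>A trigonometric inequality for the deficit case\<close>

lemma mult_cot_antimono:
  fixes u v :: real
  assumes "0 < v" "v \<le> u" "u < pi / 2"
  shows "u * (cos u * sin v) \<le> v * (sin u * cos v)"
proof -
  \<comment> \<open>This is the monotonicity of \<open>x * cot x\<close>: the numerator of its
    derivative is \<open>sin x * cos x - x\<close>.\<close>
  have "u * cos u / sin u \<le> v * cos v / sin v"
  proof (rule DERIV_nonpos_imp_nonincreasing[OF \<open>v \<le> u\<close>])
    fix x assume x: "v \<le> x" "x \<le> u"
    then have s: "0 < sin x" using assms by (intro sin_gt_zero) auto
    have "((\<lambda>x. x * cos x / sin x) has_real_derivative
        ((1 * cos x - x * sin x) * sin x - (x * cos x) * cos x) / (sin x * sin x)) (at x)"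
      using s by (auto intro!: derivative_eq_intros)
    moreover have "((1 * cos x - x * sin x) * sin x - (x * cos x) * cos x) = sin x * cos x - x * ((sin x)\<^sup>2 + (cos x)\<^sup>2)"
      by (simp add: algebra_simps power2_eq_square del: sin_cos_squared_add sin_cos_squared_add2 sin_cos_squared_add3)
    moreover have "sin x * cos x \<le> x * 1"
      using s x assms sin_x_le_x[of x] cos_ge_zero[of x] by (intro mult_mono) auto
    ultimately show "\<exists>y. ((\<lambda>x. x * cos x / sin x) has_real_derivative y) (at x) \<and> y \<le> 0"
      using s by (intro exI conjI) (auto simp: divide_nonpos_pos)
  qed
  moreover have "0 < sin u" "0 < sin v" using assms by (auto intro!: sin_gt_zero)
  ultimately show ?thesis by (simp add: field_simps)
qed

text \<open>For \<open>x = n / (n - 1)\<close> this shows that the radius forced by a deficit of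
  \<open>pi / 3\<close> is at least the claimed optimum. Equality holds at \<open>x = 1\<close>, and
  the product then decreases because \<open>u * cot u\<close> does.\<close>

lemma sin_mult_sin_reciprocal_le:
  fixes x :: real
  assumes "1 \<le> x" "x < 3"
  shows "4 * sin (pi / 6 * x) * sin (pi / 6 * (1 / x)) \<le> 1"
proof -
  have "sin (pi / 6 * x) * sin (pi / 6 * (1 / x)) \<le> sin (pi / 6 * 1) * sin (pi / 6 * (1 / 1))"
  proof (rule DERIV_nonpos_imp_nonincreasing[OF \<open>1 \<le> x\<close>])
    fix y assume y: "1 \<le> y" "y \<le> x"
    let ?u = "pi / 6 * y" and ?v = "pi / 6 * (1 / y)"
    let ?E = "cos ?u * (pi / 6) * sin ?v - sin ?u * (cos ?v * (pi / 6 * (1 / (y * y))))"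
    have y2: "1 \<le> y * y" using y mult_mono[of 1 y 1 y] by simp
    have "?v \<le> ?u" using y y2 by (simp add: field_simps)
    then have "?u * (cos ?u * sin ?v) \<le> ?v * (sin ?u * cos ?v)"
      using y assms by (intro mult_cot_antimono) auto
    moreover have "y * ?E = ?u * (cos ?u * sin ?v) - ?v * (sin ?u * cos ?v)"
      using y by (simp add: field_simps)
    ultimately have "y * ?E \<le> 0" by simp
    then have "?E \<le> 0" using y by (simp add: mult_le_0_iff)
    moreover have "((\<lambda>y. sin (pi / 6 * y) * sin (pi / 6 * (1 / y))) has_real_derivative ?E) (at y)"
      using y by (auto intro!: derivative_eq_intros simp: field_simps)
    ultimately show "\<exists>D. ((\<lambda>y. sin (pi / 6 * y) * sin (pi / 6 * (1 / y))) has_real_derivative D) (at y) \<and> D \<le> 0"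
      by blast
  qed
  also have "\<dots> = 1 / 4" by (simp add: sin_30)
  finally show ?thesis by simp
qed

subsection \<open>Flows on wheels as cycles in an annulus\<close>

text \<open>The rim values of the flows on the wheel, with \<open>R = r - 1\<close>.\<close>

definition annular_cycle :: "nat \<Rightarrow> real \<Rightarrow> (nat \<Rightarrow> complex) \<Rightarrow> bool" where
  "annular_cycle n R z \<longleftrightarrow> (\<forall>j<n. 1 \<le> cmod (z j) \<and> cmod (z j) \<le> R \<and>
     1 \<le> cmod (z (Suc j mod n) - z j) \<and> cmod (z (Suc j mod n) - z j) \<le> R)"

text \<open>Reversing an edge and negating its value changes no net flow, so every orientation can
  be replaced by the reference direction given by \<open>ends\<close>.\<close>

lemma oriented_conservation_iff:
  fixes phi :: "'e \<Rightarrow> complex"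
  assumes "finite E"
  shows "(\<Sum>e\<in>{e\<in>E. ohead ends ori e = v}. phi e) = (\<Sum>e\<in>{e\<in>E. otail ends ori e = v}. phi e) \<longleftrightarrow>
    (\<Sum>e\<in>E. if snd (ends e) = v then (if ori e then phi e else - phi e) else 0) =
    (\<Sum>e\<in>E. if fst (ends e) = v then (if ori e then phi e else - phi e) else 0)"
proof -
  have "(\<Sum>e\<in>{e\<in>E. ohead ends ori e = v}. phi e) - (\<Sum>e\<in>{e\<in>E. otail ends ori e = v}. phi e) =
    (\<Sum>e\<in>E. (if ohead ends ori e = v then phi e else 0) - (if otail ends ori e = v then phi e else 0))"
    using assms by (simp add: sum_subtractf sum.inter_filter)
  also have "\<dots> = (\<Sum>e\<in>E. (if snd (ends e) = v then (if ori e then phi e else - phi e) else 0) -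
      (if fst (ends e) = v then (if ori e then phi e else - phi e) else 0))"
    by (intro sum.cong) (auto simp: ohead_def otail_def)
  finally show ?thesis unfolding sum_subtractf by (rule diff_eq_diff_eq)
qed

lemma sum_wheel_E: "(\<Sum>e\<in>wheel_E n. f e) = (\<Sum>j<n. f (Inl j)) + (\<Sum>j<n. f (Inr j))"
  unfolding wheel_E_def
  by (subst sum.union_disjoint) (auto simp: sum.reindex)

lemma finite_wheel_E: "finite (wheel_E n)"
  by (simp add: wheel_E_def)

lemma wheel_rim_in_sum:
  fixes f :: "nat \<Rightarrow> complex"
  assumes "j < n"
  shows "(\<Sum>i<n. if Suc i mod n = Suc j mod n then f i else 0) = f j"
proof -
  have "(\<Sum>i<n. if Suc i mod n = Suc j mod n then f i else 0) = (\<Sum>i<n. if i = j then f i else 0)"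
    using assms inj_on_eq_iff[OF inj_on_cyclic_shift, of _ n j] by (intro sum.cong) auto
  then show ?thesis using assms by simp
qed

text \<open>Conservation at a rim vertex forces its spoke to carry the difference of the two rim
  values there. Conservation at the hub is then automatic, since cyclic differences sum to
  0.\<close>

lemma complex_nz_flow_wheel_iff:
  "complex_nz_flow (wheel_V n) (wheel_E n) (wheel_ends n) r \<longleftrightarrow> (\<exists>z. annular_cycle n (r - 1) z)"
proof
  assume "complex_nz_flow (wheel_V n) (wheel_E n) (wheel_ends n) r"
  then obtain ori phi where nz: "\<And>e. e \<in> wheel_E n \<Longrightarrow> 1 \<le> cmod (phi e) \<and> cmod (phi e) \<le> r - 1"
    and cons: "\<And>v. v \<in> wheel_V n \<Longrightarrow>
      (\<Sum>e\<in>{e\<in>wheel_E n. ohead (wheel_ends n) ori e = v}. phi e) =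
      (\<Sum>e\<in>{e\<in>wheel_E n. otail (wheel_ends n) ori e = v}. phi e)"
    unfolding complex_nz_flow_def by blast
  define s where "s = (\<lambda>e. if ori e then phi e else - phi e)"
  have signed: "(if ori e then phi e else - phi e) = s e" for e by (simp add: s_def)
  have cs: "cmod (s e) = cmod (phi e)" for e by (simp add: s_def)
  have step: "s (Inl (Suc j mod n)) - s (Inl j) = s (Inr (Suc j mod n))" if j: "j < n" for j
  proof -
    have "Suc j mod n < n" using j by simp
    then have "Some (Suc j mod n) \<in> wheel_V n" by (simp add: wheel_V_def)
    from cons[OF this, unfolded oriented_conservation_iff[OF finite_wheel_E] signed]
    have "(\<Sum>i<n. if Suc i mod n = Suc j mod n then s (Inl i) else 0) + s (Inr (Suc j mod n)) =
        s (Inl (Suc j mod n))"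
      using \<open>Suc j mod n < n\<close> by (simp add: sum_wheel_E wheel_ends_def)
    then show ?thesis using wheel_rim_in_sum[OF j, of "\<lambda>i. s (Inl i)"] by (simp add: algebra_simps)
  qed
  have "annular_cycle n (r - 1) (\<lambda>j. s (Inl j))"
    unfolding annular_cycle_def
  proof (intro allI impI)
    fix j assume j: "j < n"
    then have "Inl j \<in> wheel_E n" "Inr (Suc j mod n) \<in> wheel_E n" by (auto simp: wheel_E_def)
    then show "1 \<le> cmod (s (Inl j)) \<and> cmod (s (Inl j)) \<le> r - 1 \<and>
         1 \<le> cmod (s (Inl (Suc j mod n)) - s (Inl j)) \<and> cmod (s (Inl (Suc j mod n)) - s (Inl j)) \<le> r - 1"
      using nz step[OF j] by (simp add: cs)
  qed
  then show "\<exists>z. annular_cycle n (r - 1) z" by blast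
next
  assume "\<exists>z. annular_cycle n (r - 1) z"
  then obtain z where z: "annular_cycle n (r - 1) z" by blast
  \<comment> \<open>The predecessor on the rim; the spoke at \<open>j\<close>, directed away from
    the hub, has to supply \<open>z j - z (g j)\<close>.\<close>
  define g where "g = inv_into {..<n} (\<lambda>j. Suc j mod n)"
  have g: "g (Suc j mod n) = j" if "j < n" for j
    unfolding g_def using that by (intro inv_into_f_f inj_on_cyclic_shift) auto
  have ex: "\<exists>i<n. j = Suc i mod n" if "j < n" for j
  proof -
    have "j \<in> (\<lambda>i. Suc i mod n) ` {..<n}"
      using that bij_betw_imp_surj_on[OF bij_betw_cyclic_shift, of n] by simp
    then show ?thesis by blast
  qed
  define phi where "phi = case_sum z (\<lambda>j. z j - z (g j))"
  have "1 \<le> cmod (phi e) \<and> cmod (phi e) \<le> r - 1" if "e \<in> wheel_E n" for e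
  proof (cases e)
    case (Inl j)
    then show ?thesis using that z by (auto simp: wheel_E_def annular_cycle_def phi_def)
  next
    case (Inr k)
    then have "k < n" using that by (auto simp: wheel_E_def)
    then obtain j where "j < n" "k = Suc j mod n" using ex by blast
    then show ?thesis using z by (simp add: Inr annular_cycle_def phi_def g)
  qed
  moreover have "(\<Sum>e\<in>{e\<in>wheel_E n. ohead (wheel_ends n) (\<lambda>_. True) e = v}. phi e) =
      (\<Sum>e\<in>{e\<in>wheel_E n. otail (wheel_ends n) (\<lambda>_. True) e = v}. phi e)" if "v \<in> wheel_V n" for v
  proof (cases v)
    case None
    have "(\<Sum>j<n. z (g j)) = (\<Sum>j<n. z (g (Suc j mod n)))" by (rule sum_cyclic_shift[symmetric])
    also have "\<dots> = (\<Sum>j<n. z j)" by (simp add: g)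
    finally show ?thesis
      by (simp add: oriented_conservation_iff[OF finite_wheel_E] sum_wheel_E wheel_ends_def None
          phi_def sum_subtractf)
  next
    case (Some k)
    then have k: "k < n" using that by (auto simp: wheel_V_def)
    obtain j where j: "j < n" "k = Suc j mod n" using ex[OF k] by blast
    show ?thesis
      using wheel_rim_in_sum[OF j(1), of z] k
      by (simp add: oriented_conservation_iff[OF finite_wheel_E] sum_wheel_E wheel_ends_def Some
          phi_def j g cong: if_cong)
  qed
  ultimately show "complex_nz_flow (wheel_V n) (wheel_E n) (wheel_ends n) r"
    unfolding complex_nz_flow_def by blast
qed

lemma complex_flow_number_wheel_eqI:
  assumes "1 \<le> R" "annular_cycle n R z" and "\<And>S w. 1 \<le> S \<Longrightarrow> annular_cycle n S w \<Longrightarrow> R \<le> S"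
  shows "complex_flow_number (wheel_V n) (wheel_E n) (wheel_ends n) = 1 + R"
  unfolding complex_flow_number_def complex_nz_flow_wheel_iff
proof (rule cInf_eq_minimum)
  show "1 + R \<in> {r. 2 \<le> r \<and> (\<exists>z. annular_cycle n (r - 1) z)}" using assms by auto
next
  fix r assume "r \<in> {r. 2 \<le> r \<and> (\<exists>z. annular_cycle n (r - 1) z)}"
  then show "1 + R \<le> r" using assms(3)[of "r - 1"] by force
qed

section \<open>Optimal cycles for each residue class\<close>

lemma cmod_cis_diff: "cmod (cis a - cis b) = 2 * \<bar>sin ((a - b) / 2)\<bar>"
proof -
  have "(cmod (cis a - cis b))\<^sup>2 =
      ((sin a)\<^sup>2 + (cos a)\<^sup>2) + ((sin b)\<^sup>2 + (cos b)\<^sup>2) - 2 * cos (a - b)"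
    unfolding cmod_power2 cos_diff
    by (simp add: power2_eq_square algebra_simps del: sin_cos_squared_add3)
  also have "\<dots> = (2 * \<bar>sin ((a - b) / 2)\<bar>)\<^sup>2"
  proof -
    have "2 * ((a - b) / 2) = a - b" by (simp add: field_simps)
    then have "cos (a - b) = 1 - 2 * (sin ((a - b) / 2))\<^sup>2"
      using cos_double_sin[of "(a - b) / 2"] by (simp only:)
    then show ?thesis by (simp add: power_mult_distrib)
  qed
  finally show ?thesis by (rule power2_eq_imp_eq) auto
qed

text \<open>All candidate angles for odd \<open>n\<close> lie in this range, so the candidate radius
  is at most \<open>sqrt 2\<close>. A cycle with \<open>R\<^sup>2 > 2\<close> therefore needs no
  further analysis.\<close>

lemma two_sin_half_bounds:
  assumes "pi / 3 \<le> x" "x \<le> pi / 2"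
  shows "1 \<le> 2 * sin (x / 2)" "(2 * sin (x / 2))\<^sup>2 \<le> 2" "2 * \<bar>sin (x / 2)\<bar> = 2 * sin (x / 2)"
proof -
  have "sin (pi / 6) \<le> sin (x / 2)" using assms by (intro sin_monotone_2pi_le) auto
  then show 1: "1 \<le> 2 * sin (x / 2)" by (simp add: sin_30)
  then show "2 * \<bar>sin (x / 2)\<bar> = 2 * sin (x / 2)" by simp
  have "sin (x / 2) \<le> sin (pi / 4)" using assms by (intro sin_monotone_2pi_le) auto
  then have "2 * sin (x / 2) \<le> sqrt 2" by (simp add: sin_45)
  then have "(2 * sin (x / 2))\<^sup>2 \<le> (sqrt 2)\<^sup>2" using 1 by (intro power_mono) auto
  then show "(2 * sin (x / 2))\<^sup>2 \<le> 2" by simp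
qed

lemma annular_cycle_even:
  assumes "even n"
  shows "annular_cycle n 1 (\<lambda>j. if even j then 1 else cis (pi / 3))"
proof -
  have "cmod (cis (pi / 3) - cis 0) = 1" unfolding cmod_cis_diff by (simp add: sin_30)
  moreover have "even (Suc j mod n) = odd j" for j using assms by (simp add: dvd_mod_iff)
  ultimately show ?thesis by (auto simp: annular_cycle_def norm_minus_commute)
qed

lemma cis_eq_if_int_multiple:
  assumes "a = b + 2 * pi * of_int k" shows "cis a = cis b"
  by (simp add: assms cis_mult[symmetric])

text \<open>Equal steps of angle \<open>x\<close> on the unit circle close up after
  \<open>(n + 1) / 6\<close> full turns.\<close>

lemma annular_cycle_mod6_5:
  assumes n: "n mod 6 = 5" and x: "x = pi / 3 * ((real n + 1) / real n)"
  shows "annular_cycle n (2 * sin (x / 2)) (\<lambda>j. cis (real j * x))"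
proof -
  have "5 \<le> n" using n mod_less_eq_dividend[of n 6] by simp
  then have "pi / 3 * 1 \<le> x" "x \<le> pi / 3 * (3 / 2)" unfolding x
    by (intro mult_left_mono; simp add: field_simps)+
  then have b: "1 \<le> 2 * sin (x / 2)" "2 * \<bar>sin (x / 2)\<bar> = 2 * sin (x / 2)"
    using two_sin_half_bounds[of x] by auto
  define m where "m = n div 6 + 1"
  have m: "n + 1 = 6 * m" using n div_mult_mod_eq[of n 6] by (simp add: m_def)
  have "real n * x = pi / 3 * (real (n + 1))" using \<open>5 \<le> n\<close> by (simp add: x field_simps)
  also have "\<dots> = 0 + 2 * pi * of_int (int m)" unfolding m by simp
  finally have wrap: "cis (real n * x) = 1" using cis_eq_if_int_multiple[of _ 0] by simp
  have "cis (real (Suc j mod n) * x) = cis (real (Suc j) * x)" if "j < n" for j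
    using that wrap by (cases "Suc j = n") auto
  then have "cmod (cis (real (Suc j mod n) * x) - cis (real j * x)) = 2 * sin (x / 2)" if "j < n" for j
    using that b by (simp add: cmod_cis_diff algebra_simps del: of_nat_Suc) (simp add: algebra_simps)
  then show ?thesis using b by (simp add: annular_cycle_def)
qed

text \<open>After \<open>n - 1\<close> equal steps the last point lies at angle
  \<open>pi / 3\<close> modulo full turns, so the closing chord has length exactly 1.\<close>

lemma annular_cycle_mod6_1:
  assumes n: "n mod 6 = 1" "3 \<le> n" and x: "x = pi / 3 * (real n / (real n - 1))"
  shows "annular_cycle n (2 * sin (x / 2)) (\<lambda>j. cis (real j * x))"
proof -
  have "pi / 3 * 1 \<le> x" "x \<le> pi / 3 * (3 / 2)" unfolding x
    using n by (intro mult_left_mono; simp add: field_simps)+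
  then have b: "1 \<le> 2 * sin (x / 2)" "2 * \<bar>sin (x / 2)\<bar> = 2 * sin (x / 2)"
    using two_sin_half_bounds[of x] by auto
  define m where "m = n div 6"
  have m: "n = 6 * m + 1" using n div_mult_mod_eq[of n 6] by (simp add: m_def)
  have "real (n - 1) * x = pi / 3 * real n" using n by (simp add: x field_simps of_nat_diff)
  also have "\<dots> = pi / 3 + 2 * pi * of_int (int m)" unfolding m by (simp add: algebra_simps)
  finally have wrap: "cis (real (n - 1) * x) = cis (pi / 3)" by (rule cis_eq_if_int_multiple)
  have "1 \<le> cmod (cis (real (Suc j mod n) * x) - cis (real j * x)) \<and>
        cmod (cis (real (Suc j mod n) * x) - cis (real j * x)) \<le> 2 * sin (x / 2)" if "j < n" for j
  proof (cases "Suc j = n")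
    case True
    then have "j = n - 1" by simp
    have "cmod (cis (real (Suc j mod n) * x) - cis (real j * x)) = cmod (cis 0 - cis (pi / 3))"
      unfolding \<open>j = n - 1\<close> wrap using n by simp
    also have "\<dots> = 1" unfolding cmod_cis_diff by (simp add: sin_30)
    finally show ?thesis using b by simp
  next
    case False
    then show ?thesis using that b by (simp add: cmod_cis_diff algebra_simps)
  qed
  then show ?thesis using b by (simp add: annular_cycle_def)
qed

text \<open>The last point completes the rhombus on \<open>0\<close>, \<open>1\<close> and its predecessor.\<close>

lemma annular_cycle_mod6_3:
  assumes n: "n mod 6 = 3" and x: "x = pi / 3 * (real n / (real n - 1))"
  shows "annular_cycle n (2 * sin (x / 2))
    (\<lambda>j. if j = n - 1 then 1 + cis (real (n - 2) * x) else cis (real j * x))"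
    (is "annular_cycle n ?R ?z")
proof -
  have n3: "3 \<le> n" using n mod_less_eq_dividend[of n 6] by simp
  have "pi / 3 * 1 \<le> x" "x \<le> pi / 3 * (3 / 2)" unfolding x
    using n3 by (intro mult_left_mono; simp add: field_simps)+
  then have b: "1 \<le> ?R" "2 * \<bar>sin (x / 2)\<bar> = ?R"
    using two_sin_half_bounds[of x] by auto
  define m where "m = n div 6"
  have m: "n = 6 * m + 3" using n div_mult_mod_eq[of n 6] by (simp add: m_def)
  \<comment> \<open>The predecessor of the last point sits at angle \<open>pi - x\<close>. Adding 1
    to it gives a chord of the unit circle subtending the angle \<open>x\<close>, hence modulus
    \<open>2 * sin (x / 2)\<close>.\<close>
  have "real (n - 2) * x = pi / 3 * real n - x" using n3 by (simp add: x field_simps of_nat_diff)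
  also have "\<dots> = (pi - x) + 2 * pi * of_int (int m)" unfolding m by (simp add: algebra_simps)
  finally have "cis (real (n - 2) * x) = cis (pi - x)" by (rule cis_eq_if_int_multiple)
  also have "\<dots> = - cis (- x)" by (simp add: minus_cis)
  finally have c: "1 + cis (real (n - 2) * x) = cis 0 - cis (- x)" by simp
  have zn: "cmod (?z (n - 1)) = ?R"
    unfolding if_P[OF refl] c cmod_cis_diff using b by simp
  have z1: "cmod (?z j) = 1" if "j \<noteq> n - 1" for j using that by simp
  have "1 \<le> cmod (?z (Suc j mod n) - ?z j) \<and> cmod (?z (Suc j mod n) - ?z j) \<le> ?R" if "j < n" for j
  proof -
    have "j = n - 1 \<or> j = n - 2 \<or> Suc j < n - 1" using that by linarith
    then consider "j = n - 1" | "j = n - 2" | "Suc j < n - 1" by blast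
    then show ?thesis
    proof cases
      case 1
      then show ?thesis using n3 b by simp
    next
      case 2
      have "Suc (n - 2) = n - 1" "n - 2 \<noteq> n - 1" "(n - 1) mod n = n - 1" using n3 by auto
      then show ?thesis unfolding 2 using b by simp
    next
      case 3
      then have step: "?z (Suc j mod n) - ?z j = cis (real (Suc j) * x) - cis (real j * x)"
        using n3 by auto
      have "cmod (?z (Suc j mod n) - ?z j) = ?R"
        unfolding step cmod_cis_diff using b by (simp add: algebra_simps)
      then show ?thesis using b by simp
    qed
  qed
  moreover have "1 \<le> cmod (?z j) \<and> cmod (?z j) \<le> ?R" for j
  proof (cases "j = n - 1")
    case True
    show ?thesis unfolding True zn using b(1) by simp
  next
    case False
    show ?thesis unfolding z1[OF False] using b(1) by simp
  qed
  ultimately show ?thesis unfolding annular_cycle_def by blast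
qed

subsection \<open>Lower bounds for the radius\<close>

lemma annular_cycle_angles:
  assumes cyc: "annular_cycle n R z" and R: "1 \<le> R" "R\<^sup>2 \<le> 2"
    and D: "D = 2 * arcsin (R / 2) - pi / 3"
  shows "\<exists>(s :: nat \<Rightarrow> int) p f k. (\<forall>j<n. (s j = 1 \<or> s j = -1) \<and> 0 \<le> p j \<and> p j \<le> D / 2 \<and>
      f j \<le> p j + p (Suc j mod n) \<and> p j + p (Suc j mod n) - D \<le> f j \<and>
      2 * arcsin (1 / (2 * R)) - pi / 3 \<le> f j) \<and>
    (\<Sum>j<n. real_of_int (s j) * f j) = of_int (6 * k - (\<Sum>j<n. s j)) * (pi / 3)"
proof -
  have "R\<^sup>2 < 2\<^sup>2" using R by simp
  then have R2: "R < 2" using R power_less_imp_less_base by fastforce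
  have z: "1 \<le> cmod (z j)" "cmod (z j) \<le> R" "1 \<le> cmod (z (Suc j mod n) - z j)"
    "cmod (z (Suc j mod n) - z j) \<le> R" if "j < n" for j
    using that cyc unfolding annular_cycle_def by auto
  have z0: "z j \<noteq> 0" if "j < n" for j using z[OF that] by auto
  define w where "w = (\<lambda>j. Arg (z (Suc j mod n) / z j))"
  define s where "s = (\<lambda>j. if 0 \<le> w j then 1 else - 1 :: int)"
  define f where "f = (\<lambda>j. \<bar>w j\<bar> - pi / 3)"
  define p where "p = (\<lambda>j. arcsin (R / (2 * cmod (z j))) - pi / 6)"
  have arcsin_half: "arcsin (1 / 2) = pi / 6" using arcsin_sin[of "pi / 6"] by (simp add: sin_30)
  obtain k :: int where k: "(\<Sum>j<n. w j) = of_int k * 2 * pi"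
    unfolding w_def using sum_Arg_cyclic[of n z] z0 by blast
  show ?thesis
  proof (rule exI[of _ s], rule exI[of _ p], rule exI[of _ f], rule exI[of _ k], intro conjI allI impI)
    fix j assume j: "j < n"
    let ?a = "cmod (z j)" and ?b = "cmod (z (Suc j mod n))"
    have j': "Suc j mod n < n" using j by simp
    note za = z[OF j] and zb = z[OF j']
    show "s j = 1 \<or> s j = -1" by (simp add: s_def)
    have "0 < ?a" using za by linarith
    then have "1 / 2 \<le> R / (2 * ?a)" "R / (2 * ?a) \<le> R / 2"
      using za R by (simp_all add: field_simps)
    then have "arcsin (1 / 2) \<le> arcsin (R / (2 * ?a))" "arcsin (R / (2 * ?a)) \<le> arcsin (R / 2)"
      using R2 by (intro arcsin_le_arcsin; simp)+
    then show "0 \<le> p j" "p j \<le> D / 2" by (simp_all add: p_def D arcsin_half)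
    have t: "0 \<le> \<bar>w j\<bar>" "\<bar>w j\<bar> \<le> pi"
      using Arg_bounded[of "z (Suc j mod n) / z j"] by (auto simp: w_def)
    have law: "(cmod (z (Suc j mod n) - z j))\<^sup>2 = ?a\<^sup>2 + ?b\<^sup>2 - 2 * ?a * ?b * cos \<bar>w j\<bar>"
      unfolding w_def using z0[OF j] z0[OF j'] by (rule cos_law_Arg)
    then have law1: "1 \<le> ?a\<^sup>2 + ?b\<^sup>2 - 2 * ?a * ?b * cos \<bar>w j\<bar>"
      using za(3) by (metis one_le_power)
    show "f j \<le> p j + p (Suc j mod n)" "p j + p (Suc j mod n) - D \<le> f j"
      using triangle_angle_upper[OF za(1) zb(1) norm_ge_zero za(4) R(1) _ t law]
        triangle_angle_lower[OF za(1,2) zb(1,2) R(2) t law1] R2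
      by (simp_all add: p_def f_def D)
    show "2 * arcsin (1 / (2 * R)) - pi / 3 \<le> f j"
      using triangle_angle_ge_isosceles[OF za(1,2) zb(1,2) R(2) t law1] by (simp add: f_def)
  next
    \<comment> \<open>The definitions give \<open>w j = s j * (f j + pi / 3)\<close>, also when
      \<open>w j = 0\<close>, where the sign is set to 1.\<close>
    have "(\<Sum>j<n. real_of_int (s j) * f j) = (\<Sum>j<n. w j - real_of_int (s j) * (pi / 3))"
      by (intro sum.cong) (auto simp: s_def f_def)
    also have "\<dots> = of_int k * 2 * pi - of_int (\<Sum>j<n. s j) * (pi / 3)"
      by (simp add: sum_subtractf k sum_distrib_right)
    finally show "(\<Sum>j<n. real_of_int (s j) * f j) = of_int (6 * k - (\<Sum>j<n. s j)) * (pi / 3)"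
      by (simp add: algebra_simps)
  qed
qed

lemma odd_sum_of_signs:
  fixes s :: "nat \<Rightarrow> int"
  assumes "odd n" "\<And>j. j < n \<Longrightarrow> s j = 1 \<or> s j = -1"
  shows "odd (\<Sum>j<n. s j)"
proof -
  have "even (\<Sum>j<n. s j + 1)" using assms(2) by (intro dvd_sum) force
  then show ?thesis using assms(1) by (simp add: sum.distrib)
qed

lemma abs_odd_multiple_ge:
  fixes m :: int and c :: real
  assumes "odd m" "0 \<le> c"
  shows "c \<le> \<bar>of_int m * c\<bar>"
proof -
  have "1 \<le> \<bar>m\<bar>" using assms by (cases "m = 0") auto
  then have "1 \<le> \<bar>real_of_int m\<bar>" by linarith
  then show ?thesis using assms mult_right_mono[of 1 "\<bar>real_of_int m\<bar>" c] by (simp add: abs_mult)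
qed

text \<open>An odd multiple of \<open>pi / 3\<close> has modulus at least \<open>pi / 3\<close>, and
  each of the \<open>n\<close> deviations contributes at most \<open>D\<close>. This is the sharp
  bound for \<open>n\<close> congruent to 5 modulo 6.\<close>

lemma annular_cycle_odd_bound:
  assumes cyc: "annular_cycle n R z" and R: "1 \<le> R" "R\<^sup>2 \<le> 2" and n: "odd n"
  shows "pi / 3 \<le> real n * (2 * arcsin (R / 2) - pi / 3)"
proof -
  define D where "D = 2 * arcsin (R / 2) - pi / 3"
  obtain s :: "nat \<Rightarrow> int" and p f :: "nat \<Rightarrow> real" and k :: int
  where s: "\<And>j. j < n \<Longrightarrow> s j = 1 \<or> s j = -1"
    and p: "\<And>j. j < n \<Longrightarrow> 0 \<le> p j \<and> p j \<le> D / 2"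
    and f: "\<And>j. j < n \<Longrightarrow> f j \<le> p j + p (Suc j mod n) \<and> p j + p (Suc j mod n) - D \<le> f j"
    and sum: "(\<Sum>j<n. real_of_int (s j) * f j) = of_int (6 * k - (\<Sum>j<n. s j)) * (pi / 3)"
    using annular_cycle_angles[OF cyc R D_def] by blast
  have "pi / 3 \<le> \<bar>\<Sum>j<n. real_of_int (s j) * f j\<bar>"
    unfolding sum using odd_sum_of_signs[OF n s] by (intro abs_odd_multiple_ge) auto
  also have "\<dots> \<le> (\<Sum>j<n. \<bar>real_of_int (s j) * f j\<bar>)" by (rule sum_abs)
  also have "\<dots> \<le> (\<Sum>j<n. D)"
  proof (rule sum_mono)
    fix j assume "j \<in> {..<n}"
    then have j: "j < n" "Suc j mod n < n" by auto
    then have "\<bar>f j\<bar> \<le> D" using p[OF j(1)] p[OF j(2)] f[OF j(1)] by linarith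
    then show "\<bar>real_of_int (s j) * f j\<bar> \<le> D" using s[OF j(1)] by auto
  qed
  finally show ?thesis by (simp add: D_def)
qed

lemma annular_cycle_mod6_1_3_bound:
  assumes cyc: "annular_cycle n R z" and R: "1 \<le> R" "R\<^sup>2 \<le> 2"
    and n: "n mod 6 = 1 \<or> n mod 6 = 3" "3 \<le> n"
  shows "pi / 3 \<le> (real n - 1) * (2 * arcsin (R / 2) - pi / 3) \<or>
    real n * (2 * arcsin (1 / (2 * R))) \<le> pi / 3 * (real n - 1)"
proof -
  have odd: "odd n" using n by presburger
  define D where "D = 2 * arcsin (R / 2) - pi / 3"
  obtain s :: "nat \<Rightarrow> int" and p f :: "nat \<Rightarrow> real" and k :: int
  where s: "\<And>j. j < n \<Longrightarrow> s j = 1 \<or> s j = -1"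
    and p: "\<And>j. j < n \<Longrightarrow> 0 \<le> p j \<and> p j \<le> D / 2"
    and f: "\<And>j. j < n \<Longrightarrow> f j \<le> p j + p (Suc j mod n) \<and> p j + p (Suc j mod n) - D \<le> f j"
    and lo: "\<And>j. j < n \<Longrightarrow> 2 * arcsin (1 / (2 * R)) - pi / 3 \<le> f j"
    and sum: "(\<Sum>j<n. real_of_int (s j) * f j) = of_int (6 * k - (\<Sum>j<n. s j)) * (pi / 3)"
    using annular_cycle_angles[OF cyc R D_def] by blast
  show ?thesis
  proof (cases "\<exists>i<n. s i \<noteq> s (Suc i mod n)")
    case True
    then obtain i where i: "i < n" "s i \<noteq> s (Suc i mod n)" by blast
    have s': "real_of_int (s j) = 1 \<or> real_of_int (s j) = -1"
      "- real_of_int (s j) = 1 \<or> - real_of_int (s j) = -1" if "j < n" for j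
      using s[OF that] by auto
    have "(\<Sum>j<n. real_of_int (s j) * f j) \<le> (real n - 1) * D"
      by (rule cyclic_signed_sum_bound[where i = i and p = p]) (use s' i p f in auto)
    moreover have "(\<Sum>j<n. - real_of_int (s j) * f j) \<le> (real n - 1) * D"
      by (rule cyclic_signed_sum_bound[where i = i and p = p]) (use s' i p f in auto)
    ultimately have "\<bar>\<Sum>j<n. real_of_int (s j) * f j\<bar> \<le> (real n - 1) * D"
      by (simp add: sum_negf)
    moreover have "pi / 3 \<le> \<bar>\<Sum>j<n. real_of_int (s j) * f j\<bar>"
      unfolding sum using odd_sum_of_signs[OF odd s] by (intro abs_odd_multiple_ge) auto
    ultimately show ?thesis by (simp add: D_def)
  next
    case False
    then have eq: "s j = s 0" if "j < n" for j using all_eq_if_cyclically_eq[of n s] that by blast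
    have s0: "s 0 = 1 \<or> s 0 = -1" using s[of 0] n by simp
    \<comment> \<open>Multiplying the angle sum by the common sign makes \<open>c\<close> the total
      deviation in units of \<open>pi / 3\<close>.\<close>
    define c where "c = s 0 * (6 * k) - int n"
    have "(\<Sum>j<n. s j) = (\<Sum>j<n. s 0)" by (intro sum.cong refl eq) simp
    then have "(\<Sum>j<n. s j) = s 0 * int n" by simp
    moreover have "(\<Sum>j<n. real_of_int (s j) * f j) = (\<Sum>j<n. real_of_int (s 0) * f j)"
      by (intro sum.cong refl arg_cong2[where f = "(*)"] arg_cong[where f = real_of_int]) (rule eq, simp)
    then have "(\<Sum>j<n. real_of_int (s j) * f j) = of_int (s 0) * (\<Sum>j<n. f j)"
      by (simp add: sum_distrib_left)
    ultimately have sf: "(\<Sum>j<n. f j) = of_int c * (pi / 3)"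
      using sum s0 by (auto simp: c_def algebra_simps)
    have c6: "c mod 6 = (- int n) mod 6"
    proof -
      have "c = - int n + 6 * (s 0 * k)" by (simp add: c_def)
      then show ?thesis by (metis mod_mult_self2)
    qed
    \<comment> \<open>\<open>c\<close> is congruent to 5 or 3 modulo 6; the excess
      \<open>c = 1\<close> would need \<open>n\<close> congruent to 5.\<close>
    have "c \<noteq> 0" "c \<noteq> 1" "c \<noteq> -2" "c \<noteq> 2" using c6 n by presburger+
    then consider "3 \<le> \<bar>c\<bar>" | "c = -1" by linarith
    then show ?thesis
    proof cases
      case 1
      have "\<bar>\<Sum>j<n. f j\<bar> \<le> (\<Sum>j<n. \<bar>f j\<bar>)" by (rule sum_abs)
      also have "\<dots> \<le> (\<Sum>j<n. D)"
      proof (rule sum_mono)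
        fix j assume "j \<in> {..<n}"
        then have j: "j < n" "Suc j mod n < n" by auto
        then show "\<bar>f j\<bar> \<le> D" using p[OF j(1)] p[OF j(2)] f[OF j(1)] by linarith
      qed
      finally have nD: "\<bar>\<Sum>j<n. f j\<bar> \<le> real n * D" by simp
      have "3 \<le> \<bar>real_of_int c\<bar>" using 1 by linarith
      then have "3 * (pi / 3) \<le> \<bar>\<Sum>j<n. f j\<bar>"
        unfolding sf abs_mult by (intro mult_mono) auto
      then have "pi \<le> real n * D" using nD by simp
      \<comment> \<open>A total of at least \<open>pi\<close> leaves a factor 3 to spare, more than
        enough to replace \<open>n\<close> by \<open>n - 1\<close>.\<close>
      moreover have "real n * D \<le> 3 * ((real n - 1) * D)"
      proof -
        have "0 \<le> D" using p[of 0] n by auto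
        then have "real n * D \<le> (3 * (real n - 1)) * D" using n by (intro mult_right_mono) auto
        then show ?thesis by (simp only: mult.assoc)
      qed
      ultimately have "pi / 3 \<le> (real n - 1) * D" by linarith
      then show ?thesis unfolding D_def by (rule disjI1)
    next
      case 2
      \<comment> \<open>The deviations add up to \<open>- pi / 3\<close>, so the smallest possible
        angle is at most the average angle.\<close>
      have "(\<Sum>j<n. 2 * arcsin (1 / (2 * R)) - pi / 3) \<le> (\<Sum>j<n. f j)" using lo by (intro sum_mono) auto
      then show ?thesis using sf 2 by (simp add: algebra_simps)
    qed
  qed
qed

section \<open>From angle bounds to radius bounds\<close>

lemma two_sin_half_le:
  assumes "1 \<le> R" "R \<le> 2" "0 \<le> x" "x \<le> 2 * arcsin (R / 2)"
  shows "2 * sin (x / 2) \<le> R"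
proof -
  have a: "sin (arcsin (R / 2)) = R / 2" "arcsin (R / 2) \<le> pi / 2"
    using arcsin_unit_interval[of "R / 2"] assms by auto
  have "sin (x / 2) \<le> sin (arcsin (R / 2))"
    using assms a(2) by (intro sin_monotone_2pi_le) auto
  then show ?thesis using a by simp
qed

lemma annular_cycle_odd_radius:
  assumes cyc: "annular_cycle n R z" and R: "1 \<le> R" and n: "odd n" "3 \<le> n"
    and x: "x = pi / 3 * ((real n + 1) / real n)"
  shows "2 * sin (x / 2) \<le> R"
proof -
  have "pi / 3 * 1 \<le> x" "x \<le> pi / 3 * (3 / 2)" unfolding x
    using n by (intro mult_left_mono; simp add: field_simps)+
  then have x1: "pi / 3 \<le> x" "x \<le> pi / 2" by auto
  show ?thesis
  proof (cases "R\<^sup>2 \<le> 2")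
    case True
    then have "R\<^sup>2 \<le> 2\<^sup>2" by simp
    then have "R \<le> 2" using power2_le_imp_le[of R 2] by simp
    moreover have "x \<le> 2 * arcsin (R / 2)"
      using annular_cycle_odd_bound[OF cyc R True n(1)] n by (simp add: x field_simps)
    ultimately show ?thesis using R x1 pi_gt_zero by (intro two_sin_half_le) linarith+
  next
    case False
    then have "(2 * sin (x / 2))\<^sup>2 \<le> R\<^sup>2" using two_sin_half_bounds[OF x1] by linarith
    then show ?thesis by (rule power2_le_imp_le) (use R in simp)
  qed
qed

lemma annular_cycle_mod6_1_3_radius:
  assumes cyc: "annular_cycle n R z" and R: "1 \<le> R" and n: "n mod 6 = 1 \<or> n mod 6 = 3" "3 \<le> n"
    and x: "x = pi / 3 * (real n / (real n - 1))"
  shows "2 * sin (x / 2) \<le> R"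
proof -
  have "pi / 3 * 1 \<le> x" "x \<le> pi / 3 * (3 / 2)" unfolding x
    using n by (intro mult_left_mono; simp add: field_simps)+
  then have x1: "pi / 3 \<le> x" "x \<le> pi / 2" by auto
  show ?thesis
  proof (cases "R\<^sup>2 \<le> 2")
    case True
    then have "R\<^sup>2 \<le> 2\<^sup>2" by simp
    then have R2: "R \<le> 2" using power2_le_imp_le[of R 2] by simp
    from annular_cycle_mod6_1_3_bound[OF cyc R True n] show ?thesis
    proof
      assume "pi / 3 \<le> (real n - 1) * (2 * arcsin (R / 2) - pi / 3)"
      then have "x \<le> 2 * arcsin (R / 2)" using n by (simp add: x field_simps)
      then show ?thesis using R R2 x1 pi_gt_zero by (intro two_sin_half_le) linarith+
    next
      assume le: "real n * (2 * arcsin (1 / (2 * R))) \<le> pi / 3 * (real n - 1)"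
      \<comment> \<open>The half angles average \<open>pi / 6 * (1 / y)\<close>, while the claimed
        optimum has half angle \<open>pi / 6 * y\<close>. The reciprocal inequality links the
        two.\<close>
      define y where "y = real n / (real n - 1)"
      have y: "1 \<le> y" "y < 3" using n by (auto simp: y_def field_simps)
      have r: "0 \<le> 1 / (2 * R)" "1 / (2 * R) \<le> 1" using R by (auto simp: field_simps)
      have "arcsin (1 / (2 * R)) \<le> pi / 6 * (1 / y)"
        using le n by (simp add: y_def field_simps)
      moreover have "pi / 6 * (1 / y) \<le> pi / 6 * 1" using y by (intro mult_left_mono) auto
      ultimately have "sin (arcsin (1 / (2 * R))) \<le> sin (pi / 6 * (1 / y))"
        using arcsin_unit_interval[OF r] by (intro sin_monotone_2pi_le) auto
      then have "1 \<le> 2 * R * sin (pi / 6 * (1 / y))"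
        using arcsin_unit_interval[OF r] R by (simp add: field_simps)
      moreover have "4 * sin (x / 2) * sin (pi / 6 * (1 / y)) \<le> 1"
        using sin_mult_sin_reciprocal_le[OF y] by (simp add: x y_def)
      ultimately have "2 * sin (x / 2) * (2 * sin (pi / 6 * (1 / y))) \<le> R * (2 * sin (pi / 6 * (1 / y)))"
        by (simp add: algebra_simps)
      moreover have "0 < sin (pi / 6 * (1 / y))"
        using y by (intro sin_gt_zero) (auto simp: field_simps)
      ultimately show ?thesis by simp
    qed
  next
    case False
    then have "(2 * sin (x / 2))\<^sup>2 \<le> R\<^sup>2" using two_sin_half_bounds[OF x1] by linarith
    then show ?thesis by (rule power2_le_imp_le) (use R in simp)
  qed
qed

theorem theorem1:
  fixes n :: nat
  assumes "n \<ge> 3"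
  shows "complex_flow_number (wheel_V n) (wheel_E n) (wheel_ends n) =
    (if even n then 2
     else if n mod 6 = 1 \<or> n mod 6 = 3
       then 1 + 2 * sin (pi / 6 * (real n / (real n - 1)))
     else 1 + 2 * sin (pi / 6 * ((real n + 1) / real n)))"
proof -
  have "even n \<or> odd n \<and> (n mod 6 = 1 \<or> n mod 6 = 3) \<or> odd n \<and> n mod 6 = 5" by presburger
  then consider "even n" | "odd n" "n mod 6 = 1 \<or> n mod 6 = 3" | "odd n" "n mod 6 = 5" by blast
  then show ?thesis
  proof cases
    case 1
    \<comment> \<open>The constraint \<open>r \<ge> 2\<close> already gives the lower bound 1 for
      the radius.\<close>
    then show ?thesis
      using complex_flow_number_wheel_eqI[OF order_refl annular_cycle_even[OF 1]] by simp
  next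
    case 2
    define x where "x = pi / 3 * (real n / (real n - 1))"
    obtain z where "annular_cycle n (2 * sin (x / 2)) z"
      using 2(2) annular_cycle_mod6_1[OF _ assms x_def] annular_cycle_mod6_3[OF _ x_def] by blast
    moreover have "1 \<le> 2 * sin (x / 2)"
    proof -
      have "pi / 3 * 1 \<le> x" "x \<le> pi / 3 * (3 / 2)" unfolding x_def
        using assms by (intro mult_left_mono; simp add: field_simps)+
      then show ?thesis by (intro two_sin_half_bounds) auto
    qed
    ultimately have "complex_flow_number (wheel_V n) (wheel_E n) (wheel_ends n) = 1 + 2 * sin (x / 2)"
      using annular_cycle_mod6_1_3_radius[OF _ _ 2(2) assms x_def]
      by (intro complex_flow_number_wheel_eqI) auto
    then show ?thesis using 2 by (simp add: x_def)
  next
    case 3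
    define x where "x = pi / 3 * ((real n + 1) / real n)"
    have "1 \<le> 2 * sin (x / 2)"
    proof -
      have "pi / 3 * 1 \<le> x" "x \<le> pi / 3 * (3 / 2)" unfolding x_def
        using assms by (intro mult_left_mono; simp add: field_simps)+
      then show ?thesis by (intro two_sin_half_bounds) auto
    qed
    then have "complex_flow_number (wheel_V n) (wheel_E n) (wheel_ends n) = 1 + 2 * sin (x / 2)"
      using annular_cycle_odd_radius[OF _ _ 3(1) assms x_def] annular_cycle_mod6_5[OF 3(2) x_def]
      by (intro complex_flow_number_wheel_eqI) auto
    then show ?thesis using 3 by (simp add: x_def)
  qed
qed

end
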